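(* Let $E\in E_k(N,\chi)$ be a nonzero Eisenstein series with rational Fourier coefficients and suppose that no shift of $E(\chi,\chi_0,k)$ appears in the newform decomposition of $E$. Then $E$ possesses negative Fourier coefficients of arbitrarily large absolute value.
   Context: $E_k(N,\chi)$ denotes the space of Eisenstein series of integer weight $k\ge2$ and character $\chi$ on $\Gamma_0(N)$. For (possibly complex-valued) Dirichlet characters $\chi_1,\chi_2$ modulo $N_1,N_2$ and an integer $k\ge 2$ with $\chi_1\chi_2(-1)=(-1)^k$, excluding the case where $k=2$ and $\chi_1,\chi_2$ are both principal modulo $1$, put $$E(\chi_1,\chi_2,k)(z)=\frac{\delta(\chi_1)}{2}L(1-k,\chi_2)+\sum_{n\ge1}\sigma_{\chi_1,\chi_2}^{k-1}(n)q^n,\quad q=e^{2\pi i z},\qquad \sigma_{\chi_1,\chi_2}^{k-1}(n)=\sum_{d\mid n}\chi_1(n/d)\chi_2(d)d^{k-1},$$ where $\delta(\chi_1)=1$ if $\chi_1$ is principal and $0$ otherwise. A newform of level $M$ and character $\chi$ is a function $E(\chi_1,\chi_2,k)$ with $\chi_1,\chi_2$ both primitive, $M=N_1N_2$ and $\chi=\chi_1\chi_2$ (the latter character being extended to modulus $N$ when $M\mid N$). The shift by a positive integer $d$ is $(f\mid B_d)(z)=f(dz)$. The paper's standing convention (Weisinger's newform theory) is that $E_k(N,\chi)$ has a basis consisting of newforms of level $M\mid N$ with character $\chi$ and their shifts by divisors $d$ of $N/M$; the newform decomposition of $E$ is its unique expression $E=\sum_{i} c_i(E_i\mid B_{d_i})$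 with nonzero $c_i\in\mathbf{C}$ and $E_i$ such newforms. $\chi_0$ denotes the principal (trivial) character modulo $1$, and in $E(\chi,\chi_0,k)$ the symbol $\chi$ stands for the primitive character inducing $\chi$. *)

theory Defs
  imports "HOL-Analysis.Analysis" "HOL-Library.Function_Algebras"
begin

section \<open>Dirichlet characters\<close>

definition dirichlet_character :: "nat \<Rightarrow> (int \<Rightarrow> complex) \<Rightarrow> bool" where
  "dirichlet_character N chi \<longleftrightarrow>
     N > 0 \<and>
     (\<forall>a b. chi (a * b) = chi a * chi b) \<and>
     (\<forall>a. chi (a + int N) = chi a) \<and>
     (\<forall>a. chi a \<noteq> 0 \<longleftrightarrow> coprime a (int N))"

text \<open>The character modulo \<open>N\<close> induced by a character whose modulus divides \<open>N\<close>.\<close>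

definition extend_character :: "nat \<Rightarrow> (int \<Rightarrow> complex) \<Rightarrow> int \<Rightarrow> complex" where
  "extend_character N chi = (\<lambda>a. if coprime a (int N) then chi a else 0)"

definition primitive_character :: "nat \<Rightarrow> (int \<Rightarrow> complex) \<Rightarrow> bool" where
  "primitive_character N chi \<longleftrightarrow>
     dirichlet_character N chi \<and>
     (\<forall>M \<psi>. M dvd N \<and> dirichlet_character M \<psi> \<and> chi = extend_character N \<psi> \<longrightarrow> M = N)"

text \<open>A Dirichlet character is nonzero exactly at the integers coprime to its modulus, so the
  modulus need not be mentioned here.\<close>

definition principal_character :: "(int \<Rightarrow> complex) \<Rightarrow> bool" where
  "principal_character chi \<longleftrightarrow> (\<forall>a. chi a \<noteq> 0 \<longrightarrow> chi a = 1)"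

definition trivial_character :: "int \<Rightarrow> complex" where
  "trivial_character = (\<lambda>a. 1)"

text \<open>Analytic continuation of the Dirichlet series to \<open>s \<noteq> 1\<close>.  (The case \<open>s = 1\<close>, where
  the series of a principal character has a pole, is not used: below \<open>s = 1 - k\<close> with \<open>k \<ge> 2\<close>.)\<close>

definition dirichlet_L :: "(int \<Rightarrow> complex) \<Rightarrow> complex \<Rightarrow> complex" where
  "dirichlet_L chi s =
     (THE l. \<exists>F. F holomorphic_on (- {1}) \<and>
        (\<forall>w. Re w > 1 \<longrightarrow> (\<lambda>n. chi (int (Suc n)) / of_nat (Suc n) powr w) sums F w) \<and>
        F s = l)"

section \<open>Eisenstein series and their shifts\<close>

definition twisted_sigma ::
    "(int \<Rightarrow> complex) \<Rightarrow> (int \<Rightarrow> complex) \<Rightarrow> nat \<Rightarrow> nat \<Rightarrow> complex" where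
  "twisted_sigma chi1 chi2 m n =
     (\<Sum>d | d dvd n. chi1 (int (n div d)) * chi2 (int d) * of_nat d ^ m)"

text \<open>Functions on the upper half-plane are represented by functions on the complex plane that
  vanish off the upper half-plane, so that equality of functions means equality on the upper
  half-plane.  Shifts and linear combinations preserve this convention.\<close>

definition eisenstein ::
    "(int \<Rightarrow> complex) \<Rightarrow> (int \<Rightarrow> complex) \<Rightarrow> nat \<Rightarrow> complex \<Rightarrow> complex" where
  "eisenstein chi1 chi2 k z =
     (if Im z > 0 then
        (if principal_character chi1 then 1 else 0) / 2 * dirichlet_L chi2 (1 - of_nat k) +
        (\<Sum>n. twisted_sigma chi1 chi2 (k - 1) (Suc n) * exp (2 * of_real pi * \<i> * z) ^ Suc n)
      else 0)"

definition shift :: "nat \<Rightarrow> (complex \<Rightarrow> complex) \<Rightarrow> complex \<Rightarrow> complex" where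
  "shift d f = (\<lambda>z. f (of_nat d * z))"

text \<open>\<open>f\<close> is a newform of weight \<open>k\<close>, level \<open>M\<close> and character \<open>\<psi>\<close> modulo \<open>M\<close>; the moduli of the two
  characters are both 1 in the excluded case of weight 2.\<close>

definition eisenstein_newform ::
    "nat \<Rightarrow> nat \<Rightarrow> (int \<Rightarrow> complex) \<Rightarrow> (complex \<Rightarrow> complex) \<Rightarrow> bool" where
  "eisenstein_newform k M \<psi> f \<longleftrightarrow>
     k \<ge> 2 \<and>
     (\<exists>N1 chi1 N2 chi2.
        primitive_character N1 chi1 \<and> primitive_character N2 chi2 \<and>
        chi1 (- 1) * chi2 (- 1) = (- 1) ^ k \<and>
        \<not> (k = 2 \<and> N1 = 1 \<and> N2 = 1) \<and>
        M = N1 * N2 \<and> \<psi> = (\<lambda>a. chi1 a * chi2 a) \<and>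
        f = eisenstein chi1 chi2 k)"

text \<open>Pairs \<open>(f, d)\<close> of a newform \<open>f\<close> of some level \<open>M\<close> dividing \<open>N\<close>, whose character extends to
  \<open>chi\<close> modulo \<open>N\<close>, and a divisor \<open>d\<close> of \<open>N / M\<close>; such a pair stands for the shift of \<open>f\<close> by \<open>d\<close>.\<close>

definition newform_shifts ::
    "nat \<Rightarrow> nat \<Rightarrow> (int \<Rightarrow> complex) \<Rightarrow> ((complex \<Rightarrow> complex) \<times> nat) set" where
  "newform_shifts k N chi =
     {(f, d). \<exists>M \<psi>. eisenstein_newform k M \<psi> f \<and> M dvd N \<and>
                chi = extend_character N \<psi> \<and> d dvd N div M}"

text \<open>The space of Eisenstein series of weight \<open>k\<close> and character \<open>chi\<close> modulo \<open>N\<close>, following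
  Weisinger's newform theory: the complex span of the newforms and their shifts.\<close>

definition eisenstein_space ::
    "nat \<Rightarrow> nat \<Rightarrow> (int \<Rightarrow> complex) \<Rightarrow> (complex \<Rightarrow> complex) set" where
  "eisenstein_space k N chi =
     module.span (\<lambda>(c::complex) f z. c * f z) {shift d f | f d. (f, d) \<in> newform_shifts k N chi}"

definition newform_decomposition ::
    "nat \<Rightarrow> nat \<Rightarrow> (int \<Rightarrow> complex) \<Rightarrow> (complex \<Rightarrow> complex) \<Rightarrow>
     ((complex \<Rightarrow> complex) \<times> nat) set \<Rightarrow> ((complex \<Rightarrow> complex) \<times> nat \<Rightarrow> complex) \<Rightarrow> bool" where
  "newform_decomposition k N chi E I c \<longleftrightarrow>
     finite I \<and> I \<subseteq> newform_shifts k N chi \<and> (\<forall>i\<in>I. c i \<noteq> 0) \<and>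
     E = (\<lambda>z. \<Sum>(f, d)\<in>I. c (f, d) * shift d f z)"

definition fourier_coeff :: "(complex \<Rightarrow> complex) \<Rightarrow> nat \<Rightarrow> complex" where
  "fourier_coeff f =
     (THE a. \<forall>z. Im z > 0 \<longrightarrow> (\<lambda>n. a n * exp (2 * of_real pi * \<i> * z) ^ n) sums f z)"

text \<open>\<open>module.span\<close> above is the intended span.\<close>

interpretation complex_fun: vector_space "\<lambda>(c::complex) (f::complex \<Rightarrow> complex) z. c * f z"
  by unfold_locales (auto simp: fun_eq_iff algebra_simps)

end

theory Submission
  imports Defs "HOL-Number_Theory.Number_Theory"
begin

text \<open>
  Suppose the coefficients were bounded below, and let \<open>d\<close> be the smallest shift occurring in the
  decomposition. The coefficients \<open>A(m)\<close> of \<open>E\<close> at \<open>d m\<close> with \<open>m\<close> prime to \<open>N\<close> only see the terms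
  with shift \<open>d\<close>, so for \<open>u > 1\<close> their Dirichlet series at \<open>u + k - 1\<close> is a combination of products
  \<open>L(u + k - 1, \<chi>\<^sub>1) L(u, \<chi>\<^sub>2)\<close>. The hypothesis on the decomposition says that no \<open>\<chi>\<^sub>2\<close> is
  principal, so this stays bounded as \<open>u \<rightarrow> 1\<close>, and since the \<open>A(m)\<close> are real and bounded below the
  same holds for the series of \<open>\<bar>A(m)\<bar>\<close>. But twisting \<open>A\<close> by the conjugate of one of the \<open>\<chi>\<^sub>2\<close>,
  which does not increase absolute values, makes exactly one of the factors \<open>L(u, \<cdot>)\<close> principal,
  hence unbounded, while the factor \<open>L(u + k - 1, \<cdot>)\<close> next to it stays away from \<open>0\<close> because
  \<open>\<zeta>(2) < 2\<close>.
\<close>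

section \<open>Dirichlet characters\<close>

lemma extend_character_coprime [simp]:
  "coprime a (int N) \<Longrightarrow> extend_character N chi a = chi a"
  by (simp add: extend_character_def)

lemma extend_character_eq_iff:
  "extend_character N chi = extend_character N psi \<longleftrightarrow>
     (\<forall>a. coprime a (int N) \<longrightarrow> chi a = psi a)"
  by (auto simp: extend_character_def fun_eq_iff)

text \<open>Take for \<open>t\<close> the product of the primes dividing \<open>N\<close> but not
  \<open>a\<close>: a prime factor of \<open>N\<close> that divides \<open>a\<close> divides neither
  \<open>g\<close> nor \<open>t\<close>, and one that does not divide \<open>a\<close> divides
  \<open>t\<close>. This moves a residue class modulo \<open>g\<close> to a representative coprime
  to \<open>N\<close>, where characters can be compared.\<close>

lemma coprime_translate:
  fixes a g :: int
  assumes "coprime a g" "N > 0"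
  obtains t where "coprime (a + g * t) (int N)"
proof -
  define P where "P = {p \<in> prime_factors (int N). \<not> p dvd a}"
  define t where "t = \<Prod>P"
  have fin: "finite P" by (simp add: P_def)
  have "coprime (a + g * t) (int N)"
  proof (rule ccontr)
    assume "\<not> ?thesis"
    hence "\<not> is_unit (gcd (a + g * t) (int N))" by (simp add: coprime_iff_gcd_eq_1)
    moreover have "gcd (a + g * t) (int N) \<noteq> 0" using assms(2) by simp
    ultimately obtain p where "prime p" "p dvd gcd (a + g * t) (int N)"
      using prime_divisor_exists by blast
    hence p: "prime p" "p dvd a + g * t" "p dvd int N" by auto
    show False
    proof (cases "p dvd a")
      case True
      hence "p dvd g * t" using p(2) by (simp add: dvd_add_right_iff)
      moreover have "\<not> p dvd g"
        using assms(1) True p(1) by (meson coprime_common_divisor not_prime_unit)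
      ultimately have "p dvd \<Prod>P" using p(1) by (simp add: prime_dvd_mult_iff t_def)
      then obtain q where q: "q \<in> P" "p dvd q"
        using prime_dvd_prod_iff[OF fin p(1), of id] by auto
      hence "p = q" using p(1) primes_dvd_imp_eq by (auto simp: P_def in_prime_factors_iff)
      thus False using q True by (simp add: P_def)
    next
      case False
      hence "p \<in> P" using p assms by (auto simp: P_def in_prime_factors_iff)
      hence "p dvd t" unfolding t_def using fin by (rule dvd_prodI[of P p id, simplified, rotated])
      thus False using p(2) False by (simp add: dvd_add_left_iff)
    qed
  qed
  thus ?thesis by (rule that)
qed

section \<open>Periodicity of Dirichlet characters and the size of their values\<close>

context
  fixes N chi
  assumes chi: "dirichlet_character N chi"
begin

lemma modulus_pos: "N > 0"
  and character_mult: "chi (a * b) = chi a * chi b"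
  and character_nz_iff: "chi a \<noteq> 0 \<longleftrightarrow> coprime a (int N)"
  using chi by (auto simp: dirichlet_character_def)

lemma character_one: "chi 1 = 1"
  using character_mult[of 1 1] character_nz_iff[of 1] by simp

lemma character_power: "chi (a ^ n) = chi a ^ n"
  by (induction n) (simp_all add: character_one character_mult)

lemma character_add_mult: "chi (a + int N * t) = chi a"
proof -
  have *: "chi (a + int N * int n) = chi a" for a n
  proof (induction n)
    case (Suc n)
    have "chi (a + int N * int (Suc n)) = chi (a + int N * int n + int N)"
      by (simp add: algebra_simps)
    also have "\<dots> = chi a" using chi Suc by (simp add: dirichlet_character_def)
    finally show ?case .
  qed simp
  show ?thesis
    \<comment> \<open>For negative \<open>t\<close>, start at \<open>a + int N * t\<close> and step
      back up to \<open>a\<close>.\<close>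
    using *[of a "nat t"] *[of "a + int N * t" "nat (- t)"] by (cases "t \<ge> 0") auto
qed

lemma character_cong: "[a = b] (mod int N) \<Longrightarrow> chi a = chi b"
  by (metis cong_iff_lin character_add_mult)

text \<open>Powers of a value are again values, and by periodicity these form a finite set; a value
  of norm above 1 would have unbounded powers.\<close>

lemma character_norm_le: "norm (chi a) \<le> 1"
proof (rule ccontr)
  assume *: "\<not> ?thesis"
  have "bounded (chi ` {0..<int N})" by (intro finite_imp_bounded) simp
  then obtain B where B: "\<And>a. a \<in> {0..<int N} \<Longrightarrow> norm (chi a) \<le> B"
    unfolding bounded_iff by blast
  have "norm (chi a) ^ n \<le> B" for n
  proof -
    have "chi (a ^ n) = chi (a ^ n mod int N)" by (rule character_cong) simp
    thus ?thesis
      using B[of "a ^ n mod int N"] modulus_pos by (simp add: character_power flip: norm_power)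
  qed
  thus False using real_arch_pow[of "norm (chi a)" B] * by (meson not_le)
qed

text \<open>The values at \<open>a\<close> and at its inverse modulo \<open>N\<close> have product
  1, and neither norm exceeds 1.\<close>

lemma character_norm: 
  assumes "coprime a (int N)" shows "norm (chi a) = 1"
proof -
  obtain b where b: "[a * b = 1] (mod int N)" using cong_solve_coprime_int assms by blast
  have "norm (chi a) * norm (chi b) = 1"
    using character_cong[OF b] by (simp add: character_one character_mult flip: norm_mult)
  thus ?thesis using character_norm_le[of a] character_norm_le[of b]
    by (smt (verit) mult_left_le mult_nonneg_nonneg norm_ge_zero)
qed

lemma dirichlet_character_extend:
  assumes "N dvd M" "M > 0"
  shows "dirichlet_character M (extend_character M chi)"
proof -
  have cop: "coprime a (int N)" if "coprime a (int M)" for a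
    using that assms coprime_divisors[of a a "int N" "int M"] by auto
  obtain q where q: "M = N * q" using assms by auto
  have "coprime (a + int M) (int M) \<longleftrightarrow> coprime a (int M)" for a
    by (metis coprime_iff_gcd_eq_1 gcd_add2 gcd.commute add.commute)
  moreover have "chi (a + int M) = chi a" for a
    using character_add_mult[of a "int q"] q by simp
  ultimately show ?thesis
    using assms cop unfolding dirichlet_character_def extend_character_def
    by (auto simp: character_mult character_nz_iff)
qed

end

lemma dirichlet_character_mult_cnj:
  assumes "dirichlet_character N chi" "dirichlet_character N psi"
  shows "dirichlet_character N (\<lambda>a. chi a * cnj (psi a))"
  using assms by (auto simp: dirichlet_character_def)

lemma dirichlet_character_1:
  assumes "dirichlet_character 1 chi"
  shows "chi = trivial_character"
proof
  fix a
  have "chi a = chi 1" using character_cong[OF assms, of a 1] by simp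
  thus "chi a = trivial_character a"
    using character_one[OF assms] by (simp add: trivial_character_def)
qed

section \<open>Uniqueness of the primitive character inducing a given character\<close>

lemma primitive_trivial: "primitive_character 1 trivial_character"
  by (simp add: primitive_character_def dirichlet_character_def trivial_character_def)

text \<open>By the Chinese remainder theorem, an argument that is 1 modulo the gcd can be moved
  modulo \<open>N1\<close> to one that is 1 modulo \<open>N2\<close>. There \<open>chi1\<close> can
  be read off from \<open>chi2\<close>, whose value is 1.\<close>

lemma character_factors_gcd:
  assumes chi1: "dirichlet_character N1 chi1" and chi2: "dirichlet_character N2 chi2"
    and N: "N > 0"
    and eq: "\<And>a. coprime a (int N) \<Longrightarrow> chi1 a = chi2 a"
    and u: "coprime u (int N1)" and v: "coprime v (int N1)"
    and uv: "[u = v] (mod int (gcd N1 N2))"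
  shows "chi1 u = chi1 v"
proof -
  define g where "g = gcd N1 N2"
  have one: "chi1 a = 1" if a: "coprime a (int N1)" "[a = 1] (mod int g)" for a
  proof -
    obtain x y where xy: "int N1 * x + int N2 * y = int g"
      using bezout_int[of "int N1" "int N2"] by (auto simp: g_def mult.commute)
    obtain q where q: "a - 1 = int g * q" using a(2) by (auto simp: cong_iff_dvd_diff)
    \<comment> \<open>By the Bezout identity, \<open>b\<close> is congruent to \<open>a\<close>
      modulo \<open>N1\<close> and to 1 modulo \<open>N2\<close>.\<close>
    define b where "b = a - int N1 * (x * q)"
    have b1: "b = 1 + int N2 * (y * q)"
      using q unfolding b_def xy[symmetric] by (simp add: algebra_simps)
    have "coprime b (int N1)"
      using a(1) character_add_mult[OF chi1, of b "x * q"]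
      by (metis character_nz_iff[OF chi1] b_def diff_add_cancel)
    moreover have "coprime b (int N2)"
      using character_add_mult[OF chi2, of 1 "y * q"] character_nz_iff[OF chi2] b1
      by (metis coprime_1_left)
    ultimately have "coprime b (int N1 * int N2)" by simp
    \<comment> \<open>Adding multiples of \<open>N1 * N2\<close> keeps both residues and reaches an
      integer to which \<open>eq\<close> applies.\<close>
    then obtain t where t: "coprime (b + int N1 * int N2 * t) (int N)"
      using coprime_translate[of b "int N1 * int N2" N] N by blast
    have "chi1 a = chi1 (b + int N1 * int N2 * t)"
      by (rule character_cong[OF chi1]) (auto simp: cong_iff_dvd_diff b_def)
    also have "\<dots> = chi2 (b + int N1 * int N2 * t)" using eq t by simp
    also have "\<dots> = chi2 1"
      by (rule character_cong[OF chi2]) (auto simp: cong_iff_dvd_diff b1)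
    finally show ?thesis using character_one[OF chi2] by simp
  qed
  \<comment> \<open>Multiplication by an inverse of \<open>v\<close> reduces the claim to an
    argument that is 1 modulo \<open>g\<close>.\<close>
  obtain w where w: "[v * w = 1] (mod int N1)" using cong_solve_coprime_int v by blast
  have cw: "coprime w (int N1)"
    using w by (metis coprime_iff_invertible_int mult.commute)
  have gN: "int g dvd int N1" by (simp add: g_def)
  have "[u * w = v * w] (mod int g)" using uv unfolding g_def by (rule cong_scalar_right)
  hence "[u * w = 1] (mod int g)" using w gN by (meson cong_dvd_modulus cong_trans)
  hence "chi1 (u * w) = 1" using u cw by (intro one) auto
  moreover have "chi1 (v * w) = 1" using character_cong[OF chi1 w] character_one[OF chi1] by simp
  moreover have "chi1 w \<noteq> 0" using cw character_nz_iff[OF chi1] by blast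
  ultimately show ?thesis by (metis character_mult[OF chi1] mult_right_cancel)
qed

text \<open>Since \<open>chi1\<close> depends only on residues modulo the gcd of the moduli, it is
  induced by a character \<open>psi\<close> of that modulus. Primitivity then forces the gcd to be
  \<open>N1\<close>.\<close>

lemma primitive_dvd:
  assumes prim: "primitive_character N1 chi1" and chi2: "dirichlet_character N2 chi2"
    and N: "N > 0"
    and eq: "\<And>a. coprime a (int N) \<Longrightarrow> chi1 a = chi2 a"
  shows "N1 dvd N2"
proof -
  have chi1: "dirichlet_character N1 chi1" using prim by (simp add: primitive_character_def)
  define g where "g = gcd N1 N2"
  have gpos: "g > 0" using modulus_pos[OF chi1] by (simp add: g_def)
  have key: "chi1 u = chi1 v" 
    if "coprime u (int N1)" "coprime v (int N1)" "[u = v] (mod int g)" for u v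
    using character_factors_gcd[OF chi1 chi2 N eq that(1,2)] that(3) by (simp add: g_def)
  \<comment> \<open>An integer coprime to \<open>g\<close> need not be coprime to \<open>N1\<close>,
    where \<open>chi1\<close> is nonzero, so \<open>psi\<close> is read off at another
    representative of its class modulo \<open>g\<close>; by \<open>key\<close> the choice is
    immaterial.\<close>
  define L where "L a = (SOME b. [b = a] (mod int g) \<and> coprime b (int N1))" for a
  have L: "[L a = a] (mod int g)" "coprime (L a) (int N1)" if "coprime a (int g)" for a
  proof -
    obtain t where "coprime (a + int g * t) (int N1)"
      using coprime_translate modulus_pos[OF chi1] \<open>coprime a (int g)\<close> by blast
    moreover have "[a + int g * t = a] (mod int g)" by (simp add: cong_iff_dvd_diff)
    ultimately have "[L a = a] (mod int g) \<and> coprime (L a) (int N1)"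
      unfolding L_def by (intro someI) blast
    thus "[L a = a] (mod int g)" "coprime (L a) (int N1)" by auto
  qed
  define psi where "psi a = (if coprime a (int g) then chi1 (L a) else 0)" for a
  have psi: "psi a = chi1 b" if "coprime b (int N1)" "[b = a] (mod int g)" "coprime a (int g)" for a b
    using key[OF L(2)[OF that(3)] that(1)] cong_trans[OF L(1)[OF that(3)] cong_sym[OF that(2)]] that(3)
    by (simp add: psi_def)
  have "dirichlet_character g psi"
    unfolding dirichlet_character_def
  proof (intro conjI allI gpos)
    fix a b
    show "psi (a * b) = psi a * psi b"
    proof (cases "coprime a (int g) \<and> coprime b (int g)")
      case True
      hence "psi (a * b) = chi1 (L a * L b)" using L[of a] L[of b]
        by (intro psi) (auto intro: cong_mult)
      thus ?thesis using True by (simp add: psi_def character_mult[OF chi1])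
    qed (auto simp: psi_def)
  next
    fix a
    have c: "coprime (a + int g) (int g) \<longleftrightarrow> coprime a (int g)"
      by (metis coprime_iff_gcd_eq_1 gcd_add2 gcd.commute add.commute)
    show "psi (a + int g) = psi a"
    proof (cases "coprime a (int g)")
      case True
      thus ?thesis using L[of a] c
        by (subst psi[of "L a"]) (auto simp: psi_def cong_iff_dvd_diff diff_diff_eq[symmetric])
    qed (auto simp: psi_def c)
  next
    fix a
    show "psi a \<noteq> 0 \<longleftrightarrow> coprime a (int g)"
      using L[of a] character_nz_iff[OF chi1] by (auto simp: psi_def)
  qed
  moreover have "chi1 = extend_character N1 psi"
  proof
    fix a
    have "coprime a (int g)" if "coprime a (int N1)"
      using that coprime_divisors[of a a "int g" "int N1"] by (simp add: g_def)
    thus "chi1 a = extend_character N1 psi a"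
      using character_nz_iff[OF chi1, of a] by (auto simp: extend_character_def psi[of a a])
  qed
  moreover have "g dvd N1" by (simp add: g_def)
  ultimately have "g = N1" using prim unfolding primitive_character_def by blast
  thus ?thesis unfolding g_def by (metis gcd_dvd2)
qed

text \<open>Each modulus divides the other, and every class coprime to the common modulus contains
  an integer coprime to \<open>N\<close>, where the two characters agree. Hence extension to modulus
  \<open>N\<close> loses no information about primitive characters.\<close>

lemma primitive_character_unique:
  assumes prim: "primitive_character N1 chi1" "primitive_character N2 chi2"
    and N: "N > 0"
    and eq: "extend_character N chi1 = extend_character N chi2"
  shows "N1 = N2" and "chi1 = chi2"
proof -
  have chi: "dirichlet_character N1 chi1" "dirichlet_character N2 chi2"
    using prim by (simp_all add: primitive_character_def)
  have eq': "chi1 a = chi2 a" if "coprime a (int N)" for a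
    using eq that by (simp add: extend_character_eq_iff)
  show N12: "N1 = N2"
    using primitive_dvd[OF prim(1) chi(2) N] primitive_dvd[OF prim(2) chi(1) N]
    by (simp add: eq' dvd_antisym)
  show "chi1 = chi2"
  proof
    fix a
    show "chi1 a = chi2 a"
    proof (cases "coprime a (int N1)")
      case True
      then obtain t where "coprime (a + int N1 * t) (int N)" using coprime_translate N by blast
      from eq'[OF this] show ?thesis
        using character_add_mult[OF chi(1)] character_add_mult[OF chi(2)] by (simp add: N12)
    next
      case False
      thus ?thesis using character_nz_iff[OF chi(1), of a] character_nz_iff[OF chi(2), of a]
        by (simp add: N12)
    qed
  qed
qed

section \<open>Dirichlet series\<close>

lemma powr_minus_summable_on:
  assumes "s > 1"
  shows "(\<lambda>n. real n powr - s) summable_on {0<..}"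
proof -
  have "(\<lambda>n. real n powr - s) summable_on UNIV"
    using assms by (simp add: summable_on_UNIV_nonneg_real_iff summable_real_powr_iff)
  thus ?thesis by (rule summable_on_subset_banach) auto
qed

text \<open>The value L(s, \<chi>) for real s > 1, written as an unordered sum so that a product of
  two such series can be regrouped by divisors.\<close>

definition dirichlet_series :: "(int \<Rightarrow> complex) \<Rightarrow> real \<Rightarrow> complex" where
  "dirichlet_series chi s = (\<Sum>\<^sub>\<infinity>n\<in>{0<..}. chi (int n) * of_real (real n powr - s))"

definition zeta2 :: real where
  "zeta2 = (\<Sum>\<^sub>\<infinity>n\<in>{0<..}. real n powr - 2)"

lemma zeta2_has_sum: "((\<lambda>n. real n powr - 2) has_sum zeta2) {0<..}"
  unfolding zeta2_def by (intro has_sum_infsum powr_minus_summable_on) simp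

lemma powr_minus_le_2:
  assumes "n > 0" "s \<ge> 2"
  shows "real n powr - s \<le> real n powr - 2"
  using assms by (intro powr_mono) auto

context
  fixes chi :: "int \<Rightarrow> complex"
  assumes norm_le: "\<And>a. norm (chi a) \<le> 1"
begin

lemma dirichlet_series_norm_term:
  "norm (chi (int n) * of_real (real n powr - s)) \<le> real n powr - s"
  using norm_le[of "int n"] by (simp add: norm_mult mult_left_le_one_le)

lemma dirichlet_series_abs_summable:
  "s > 1 \<Longrightarrow> (\<lambda>n. norm (chi (int n) * of_real (real n powr - s))) summable_on {0<..}"
  by (rule Infinite_Sum.abs_summable_on_comparison_test'[OF powr_minus_summable_on dirichlet_series_norm_term])

lemma dirichlet_series_has_sum:
  "s > 1 \<Longrightarrow> ((\<lambda>n. chi (int n) * of_real (real n powr - s)) has_sum dirichlet_series chi s) {0<..}"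
  unfolding dirichlet_series_def
  by (rule has_sum_infsum[OF Infinite_Sum.abs_summable_summable[OF dirichlet_series_abs_summable]])

lemma norm_dirichlet_series_le:
  assumes "s \<ge> 2" shows "norm (dirichlet_series chi s) \<le> zeta2"
proof (rule norm_infsum_le)
  show "((\<lambda>n. chi (int n) * of_real (real n powr - s)) has_sum dirichlet_series chi s) {0<..}"
    using assms by (intro dirichlet_series_has_sum) auto
  show "norm (chi (int n) * of_real (real n powr - s)) \<le> real n powr - 2" if "n \<in> {0<..}" for n
    using dirichlet_series_norm_term[of n s] powr_minus_le_2[of n s] that assms by simp
qed (rule zeta2_has_sum)

end

text \<open>Telescoping with 1/n^2 \<le> 1/(n-1) - 1/n from n = 3 on. The term 1/4 at n = 2 is kept
  exactly, which gives 3/4 = 1/4 + 1/2 and so a total below 1.\<close>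

lemma sum_inverse_squares_le: "(\<Sum>n=2..m + 2. real n powr - 2) \<le> 3 / 4 - 1 / real (m + 2)"
proof (induction m)
  case 0
  show ?case by (simp add: powr_minus powr_numeral power2_eq_square)
next
  case (Suc m)
  define x where "x = real m + 2"
  have x: "x > 0" "real (m + 2) = x" "real (m + 3) = x + 1" "real (Suc m + 2) = x + 1"
    by (simp_all add: x_def)
  have "{2..Suc m + 2} = insert (m + 3) {2..m + 2}" by auto
  hence "(\<Sum>n=2..Suc m + 2. real n powr - 2) = real (m + 3) powr - 2 + (\<Sum>n=2..m + 2. real n powr - 2)"
    by simp
  moreover have "real (m + 3) powr - 2 \<le> 1 / x - 1 / (x + 1)"
  proof -
    have "real (m + 3) powr - 2 = 1 / (x + 1)\<^sup>2"
      unfolding x using x(1) by (simp add: powr_minus powr_numeral divide_inverse)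
    also have "\<dots> \<le> 1 / (x * (x + 1))"
      using x(1) by (intro divide_left_mono) (auto simp: power2_eq_square)
    also have "\<dots> = 1 / x - 1 / (x + 1)" using x(1) by (simp add: field_simps)
    finally show ?thesis .
  qed
  ultimately show ?case using Suc unfolding x by linarith
qed

lemma infsum_inverse_squares_le: "(\<Sum>\<^sub>\<infinity>n\<in>{1<..}. real n powr - 2) \<le> 3 / 4"
proof (rule infsum_le_finite_sums)
  show "(\<lambda>n. real n powr - 2) summable_on {1<..}"
    by (rule summable_on_subset_banach[OF powr_minus_summable_on[of 2]]) auto
  fix F :: "nat set" assume F: "finite F" "F \<subseteq> {1<..}"
  have "x \<le> Max (insert 0 F)" if "x \<in> F" for x using F(1) that by (intro Max_ge) auto
  moreover have "2 \<le> x" if "x \<in> F" for x using F(2) that by fastforce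
  ultimately have "F \<subseteq> {2..Max (insert 0 F) + 2}"
    unfolding subset_iff atLeastAtMost_iff by (meson trans_le_add1)
  hence "(\<Sum>n\<in>F. real n powr - 2) \<le> (\<Sum>n=2..Max (insert 0 F) + 2. real n powr - 2)"
    by (intro sum_mono2) auto
  also have "\<dots> \<le> 3 / 4" using sum_inverse_squares_le[of "Max (insert 0 F)"]
    by (rule order_trans) simp
  finally show "(\<Sum>n\<in>F. real n powr - 2) \<le> 3 / 4" .
qed

text \<open>The term at n = 1 equals 1 and the remaining ones add up to at most 3/4 in norm,
  uniformly in \<open>s\<close> and \<open>chi\<close>.\<close>

lemma norm_dirichlet_series_ge:
  assumes chi: "\<And>a. norm (chi a) \<le> 1" "chi 1 = 1" and s: "s \<ge> 2"
  shows "norm (dirichlet_series chi s) \<ge> 1 / 4"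
proof -
  let ?f = "\<lambda>n. chi (int n) * of_real (real n powr - s)"
  have ins: "{0::nat<..} = insert 1 {1<..}" by auto
  have sum: "?f summable_on {1<..}"
    using has_sum_imp_summable[OF dirichlet_series_has_sum[of chi s]] chi s
    by (auto intro: summable_on_subset_banach)
  hence "dirichlet_series chi s = 1 + (\<Sum>\<^sub>\<infinity>n\<in>{1<..}. ?f n)"
    unfolding dirichlet_series_def ins by (subst infsum_insert) (auto simp: chi)
  moreover have "norm (\<Sum>\<^sub>\<infinity>n\<in>{1<..}. ?f n) \<le> (\<Sum>\<^sub>\<infinity>n\<in>{1<..}. real n powr - 2)"
  proof (rule norm_infsum_le)
    show "(?f has_sum (\<Sum>\<^sub>\<infinity>n\<in>{1<..}. ?f n)) {1<..}" using sum by simp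
    show "((\<lambda>n. real n powr - 2) has_sum (\<Sum>\<^sub>\<infinity>n\<in>{1<..}. real n powr - 2)) {1::nat<..}"
      by (intro has_sum_infsum summable_on_subset_banach[OF powr_minus_summable_on[of 2]]) auto
    show "norm (?f n) \<le> real n powr - 2" if "n \<in> {1<..}" for n
      using dirichlet_series_norm_term[of chi n s] powr_minus_le_2[of n s] that s chi
      by (auto intro: order_trans)
  qed
  ultimately show ?thesis
    using infsum_inverse_squares_le norm_triangle_ineq2[of 1 "- (\<Sum>\<^sub>\<infinity>n\<in>{1<..}. ?f n)"] by simp
qed

section \<open>Boundedness of the series of non-principal characters near s = 1\<close>

lemma norm_sum_mult_antimono_le:
  fixes f :: "nat \<Rightarrow> complex" and b :: "nat \<Rightarrow> real"
  assumes K: "\<And>n. norm (\<Sum>i<n. f i) \<le> K" and b: "antimono b" "\<And>n. b n \<ge> 0"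
  shows "norm (\<Sum>i<n. f i * of_real (b i)) \<le> K * b 0"
proof -
  define S where "S n = (\<Sum>i<n. f i)" for n
  \<comment> \<open>Abel summation; the differences of \<open>b\<close> are nonnegative and
    telescope, so only \<open>b 0\<close> survives in the bound.\<close>
  have "(\<Sum>i<n. f i * of_real (b i)) =
      S n * of_real (b n) + (\<Sum>i<n. S (Suc i) * of_real (b i - b (Suc i)))"
    by (induction n) (simp_all add: S_def algebra_simps)
  also have "norm \<dots> \<le> K * b n + (\<Sum>i<n. K * (b i - b (Suc i)))"
  proof (intro norm_triangle_mono sum_norm_le)
    show "norm (S n * of_real (b n)) \<le> K * b n"
      using K[of n] b(2)[of n] by (simp add: S_def norm_mult mult_right_mono)
    fix i
    have "b (Suc i) \<le> b i" using b(1) by (simp add: antimono_def)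
    moreover have "norm (S (Suc i)) \<le> K" using K[of "Suc i"] by (simp only: S_def)
    ultimately show "norm (S (Suc i) * of_real (b i - b (Suc i))) \<le> K * (b i - b (Suc i))"
      by (simp add: norm_mult mult_right_mono del: of_real_diff)
  qed
  also have "\<dots> = K * b 0"
    by (simp only: sum_distrib_left[symmetric] sum_lessThan_telescope') (simp add: algebra_simps)
  finally show ?thesis .
qed

text \<open>Multiplication by \<open>b\<close> permutes the residues modulo \<open>N\<close>, so the
  sum is unchanged when multiplied by \<open>chi b\<close>, which differs from 1.\<close>

lemma character_sum_period:
  assumes chi: "dirichlet_character N chi" and b: "coprime b (int N)" "chi b \<noteq> 1"
  shows "(\<Sum>a<N. chi (int a)) = 0"
proof -
  define h where "h a = nat (int a * b mod int N)" for a
  have N: "N > 0" using modulus_pos[OF chi] .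
  have h: "int (h a) = int a * b mod int N" for a using N by (simp add: h_def)
  have "inj_on h {..<N}"
  proof (rule inj_onI)
    fix x y assume xy: "x \<in> {..<N}" "y \<in> {..<N}" "h x = h y"
    hence "[int x * b = int y * b] (mod int N)" using h[of x] h[of y] by (simp add: cong_def)
    hence "[int x = int y] (mod int N)" using b(1) by (simp add: cong_mult_rcancel)
    thus "x = y" using xy by (simp add: cong_def)
  qed
  moreover have "h ` {..<N} \<subseteq> {..<N}"
  proof safe
    fix a
    have "int (h a) < int N" unfolding h using N by simp
    thus "h a < N" by simp
  qed
  ultimately have "bij_betw h {..<N} {..<N}"
    by (simp add: bij_betw_def endo_inj_surj)
  hence "(\<Sum>a<N. chi (int a)) = (\<Sum>a<N. chi (int (h a)))"
    by (rule sum.reindex_bij_betw[symmetric])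
  also have "\<dots> = (\<Sum>a<N. chi b * chi (int a))"
  proof (rule sum.cong)
    fix a
    have "chi (int (h a)) = chi (int a * b)" unfolding h by (rule character_cong[OF chi]) simp
    thus "chi (int (h a)) = chi b * chi (int a)" by (simp add: character_mult[OF chi])
  qed simp
  also have "\<dots> = chi b * (\<Sum>a<N. chi (int a))" by (simp add: sum_distrib_left)
  finally show ?thesis using b(2) by simp
qed

text \<open>Full periods cancel, which leaves fewer than \<open>N\<close> terms of norm at most
  1.\<close>

lemma norm_character_sum_le:
  assumes chi: "dirichlet_character N chi" and b: "coprime b (int N)" "chi b \<noteq> 1"
  shows "norm (\<Sum>a<n. chi (int a)) \<le> real N"
proof (induction n rule: less_induct)
  case (less n)
  show ?case
  proof (cases "n < N")
    case True
    have "norm (\<Sum>a<n. chi (int a)) \<le> (\<Sum>a<n. 1)"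
      by (intro sum_norm_le character_norm_le[OF chi])
    thus ?thesis using True by simp
  next
    case False
    then obtain m where m: "n = N + m" using le_Suc_ex not_less by blast
    have split: "(\<Sum>a<N + m. f a) = (\<Sum>a<N. f a) + (\<Sum>a<m. f (N + a))" for f :: "nat \<Rightarrow> complex"
      by (induction m) (simp_all add: add.assoc)
    have "chi (int N + int a) = chi (int a)" for a
      using character_add_mult[OF chi, of "int a" 1] by (simp add: add.commute)
    hence "(\<Sum>a<n. chi (int a)) = (\<Sum>a<m. chi (int a))"
      unfolding m split using character_sum_period[OF assms] by simp
    moreover have "m < n" using m modulus_pos[OF chi] by simp
    ultimately show ?thesis using less by simp
  qed
qed

lemma norm_dirichlet_series_nonprincipal_le:
  assumes chi: "dirichlet_character N chi" and b: "coprime b (int N)" "chi b \<noteq> 1" and s: "s > 1"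
  shows "norm (dirichlet_series chi s) \<le> real N + 1"
proof -
  let ?f = "\<lambda>n. chi (int n) * of_real (real n powr - s)"
  have "(?f has_sum dirichlet_series chi s) {0<..}"
    using character_norm_le[OF chi] s by (rule dirichlet_series_has_sum)
  moreover have "bij_betw Suc UNIV {0<..}"
    by (auto simp: bij_betw_def image_iff gr0_conv_Suc)
  ultimately have "((\<lambda>n. ?f (Suc n)) has_sum dirichlet_series chi s) UNIV"
    using has_sum_reindex_bij_betw[of Suc UNIV "{0<..}" ?f] by blast
  hence "(\<lambda>n. ?f (Suc n)) sums dirichlet_series chi s" by (rule has_sum_imp_sums)
  hence lim: "(\<lambda>n. \<Sum>i<n. ?f (Suc i)) \<longlonglongrightarrow> dirichlet_series chi s" by (simp add: sums_def)
  have K: "norm (\<Sum>i<n. chi (int (Suc i))) \<le> real N + 1" for n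
  proof -
    \<comment> \<open>The series starts at 1 while the bounded character sums start at 0; removing
      \<open>chi 0\<close> costs the additional 1.\<close>
    have "(\<Sum>i<n. chi (int (Suc i))) = (\<Sum>i<Suc n. chi (int i)) - chi 0"
      by (subst sum.lessThan_Suc_shift) simp
    also have "norm \<dots> \<le> real N + 1"
      by (intro norm_triangle_le_diff add_mono norm_character_sum_le[OF chi b] character_norm_le[OF chi])
    finally show ?thesis .
  qed
  have "norm (\<Sum>i<n. ?f (Suc i)) \<le> (real N + 1) * (real (Suc 0) powr - s)" for n
    using K by (rule norm_sum_mult_antimono_le) (use s in \<open>auto simp: antimono_def intro!: powr_mono2'\<close>)
  hence "norm (\<Sum>i<n. ?f (Suc i)) \<le> real N + 1" for n by simp
  thus ?thesis by (intro tendsto_upperbound[OF tendsto_norm[OF lim]]) auto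
qed

section \<open>Dirichlet series of twisted divisor sums, and divergence for principal
  characters\<close>

lemma twisted_sigma_has_sum:
  assumes chi1: "\<And>a. norm (chi1 a) \<le> 1" and chi2: "\<And>a. norm (chi2 a) \<le> 1" and u: "u > 1"
  shows "((\<lambda>m. twisted_sigma chi1 chi2 r m * of_real (real m powr - (u + real r))) has_sum
           dirichlet_series chi1 (u + real r) * dirichlet_series chi2 u) {0<..}"
proof -
  let ?s = "u + real r"
  define f where "f d = chi1 (int d) * complex_of_real (real d powr - ?s)" for d
  define g where "g e = chi2 (int e) * complex_of_real (real e powr - u)" for e
  have f: "(\<lambda>d. norm (f d)) summable_on {0<..}" "(f has_sum dirichlet_series chi1 ?s) {0<..}"
    unfolding f_def
    by (intro dirichlet_series_abs_summable dirichlet_series_has_sum chi1; use u in simp)+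
  have g: "(\<lambda>e. norm (g e)) summable_on {0<..}" "(g has_sum dirichlet_series chi2 u) {0<..}"
    unfolding g_def by (intro dirichlet_series_abs_summable dirichlet_series_has_sum chi2 u)+
  have summ: "(\<lambda>x. norm (case x of (d, e) \<Rightarrow> f d * g e)) summable_on {0<..} \<times> {0<..}"
    unfolding Infinite_Sum.abs_summable_on_Sigma_iff
    using f(1) g(1)
    by (auto simp: norm_mult infsum_cmult_right' infsum_nonneg
             intro: summable_on_cmult_right summable_on_cmult_left)
  have prod: "((\<lambda>(d, e). f d * g e) has_sum dirichlet_series chi1 ?s * dirichlet_series chi2 u)
     ({0<..} \<times> {0<..})"
    using summ f(2) g(2) Infinite_Sum.abs_summable_summable[OF summ]
    by (intro has_sum_SigmaI) (auto intro: has_sum_cmult_right has_sum_cmult_left)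
  \<comment> \<open>Dirichlet convolution: the pairs (d, e) are grouped by their product m = d e.
    The weight e^r then accounts for the two different exponents u + r and u.\<close>
  have "((\<lambda>(m, e). f (m div e) * g e) has_sum dirichlet_series chi1 ?s * dirichlet_series chi2 u)
     (SIGMA m:{0<..}. {e. e dvd m})"
    using prod by (subst has_sum_reindex_bij_witness[where i = "\<lambda>(d, e). (d * e, e)"
         and j = "\<lambda>(m, e). (m div e, e)" and T = "{0<..} \<times> {0<..}"]) (auto elim: dvdE dest: dvd_pos_nat)
  hence "((\<lambda>m. \<Sum>e | e dvd m. f (m div e) * g e) has_sum
      dirichlet_series chi1 ?s * dirichlet_series chi2 u) {0<..}"
    by (rule has_sum_SigmaD) (auto intro!: has_sum_finiteI)
  also have "?this \<longleftrightarrow> ?thesis"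
  proof (rule has_sum_cong)
    fix m :: nat assume m: "m \<in> {0<..}"
    have "f (m div e) * g e =
        chi1 (int (m div e)) * chi2 (int e) * of_nat e ^ r * of_real (real m powr - ?s)"
      if "e dvd m" for e
    proof -
      obtain d where d: "m = e * d" using \<open>e dvd m\<close> by (elim dvdE)
      have pos: "d > 0" "e > 0" using m d by auto
      have "real e powr - u = real e ^ r * real e powr - ?s"
        using pos by (simp add: powr_realpow[symmetric] flip: powr_add)
      thus ?thesis using pos unfolding d f_def g_def by (simp add: powr_mult algebra_simps)
    qed
    thus "(\<Sum>e | e dvd m. f (m div e) * g e) =
        twisted_sigma chi1 chi2 r m * of_real (real m powr - ?s)"
      by (simp add: twisted_sigma_def sum_distrib_right)
  qed
  finally show ?thesis .
qed

text \<open>All terms are nonnegative reals, so it suffices to keep finitely many n that are 1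
  modulo \<open>N\<close>, where the character is 1.\<close>

lemma norm_dirichlet_series_principal_ge:
  assumes chi: "dirichlet_character N chi" "\<And>a. coprime a (int N) \<Longrightarrow> chi a = 1" and s: "s > 1"
  shows "(\<Sum>j<J. real (1 + N * j) powr - s) \<le> norm (dirichlet_series chi s)"
proof -
  let ?f = "\<lambda>n. chi (int n) * of_real (real n powr - s)"
  have N: "N > 0" using modulus_pos chi by blast
  have val: "chi a = (if coprime a (int N) then 1 else 0)" for a
    using chi(2) character_nz_iff[OF chi(1)] by auto
  have inj: "inj_on (\<lambda>j. 1 + N * j) {..<J}" using N by (auto simp: inj_on_def)
  have sum: "((\<lambda>n. Re (?f n)) has_sum Re (dirichlet_series chi s)) {0<..}"
    using character_norm_le[OF chi(1)] s by (intro has_sum_Re dirichlet_series_has_sum)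
  have "(\<Sum>j<J. real (1 + N * j) powr - s) = (\<Sum>j<J. Re (?f (1 + N * j)))"
  proof (rule sum.cong)
    fix j
    have "chi (int (1 + N * j)) = 1"
      using character_add_mult[OF chi(1), of 1 "int j"] character_one[OF chi(1)] by simp
    thus "real (1 + N * j) powr - s = Re (?f (1 + N * j))" by simp
  qed simp
  also have "\<dots> = (\<Sum>n\<in>(\<lambda>j. 1 + N * j) ` {..<J}. Re (?f n))"
    by (simp only: sum.reindex[OF inj] o_def)
  also have "\<dots> \<le> Re (dirichlet_series chi s)"
    using sum by (rule finite_sum_le_has_sum) (auto simp: val)
  also have "\<dots> \<le> norm (dirichlet_series chi s)" by (rule complex_Re_le_cmod)
  finally show ?thesis .
qed

text \<open>In each finite sum \<open>u\<close> may tend to 1, which would bound the sums of 1/(1 +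
  N j). Since 1 + N j \<le> N (j + 1), the harmonic series would converge.\<close>

lemma arithmetic_progression_sum_unbounded:
  assumes N: "N > 0" and K: "\<And>J u. u > 1 \<Longrightarrow> (\<Sum>j<J. real (1 + N * j) powr - u) \<le> K"
  shows False
proof -
  have le: "(\<Sum>j<J. inverse (real (1 + N * j))) \<le> K" for J
  proof -
    have "((\<lambda>u. \<Sum>j<J. real (1 + N * j) powr - u) \<longlongrightarrow> (\<Sum>j<J. real (1 + N * j) powr - 1)) (at_right 1)"
      by (intro tendsto_intros) (auto simp: add_nonneg_eq_0_iff)
    moreover have "eventually (\<lambda>u. (\<Sum>j<J. real (1 + N * j) powr - u) \<le> K) (at_right 1)"
      using K by (simp add: eventually_at_filter)
    ultimately have "(\<Sum>j<J. real (1 + N * j) powr - 1) \<le> K"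
      by (rule tendsto_upperbound) simp
    thus ?thesis by (simp add: powr_minus del: of_nat_Suc)
  qed
  have "summable (\<lambda>j. inverse (real (Suc j)))"
  proof (rule bounded_imp_summable)
    fix J
    have "(\<Sum>j\<le>J. inverse (real (Suc j))) \<le> (\<Sum>j<Suc J. real N * inverse (real (1 + N * j)))"
    proof (unfold lessThan_Suc_atMost, rule sum_mono)
      fix j
      have "real (1 + N * j) \<le> real (N * Suc j)" unfolding of_nat_le_iff using N by simp
      hence "inverse (real (N * Suc j)) \<le> inverse (real (1 + N * j))"
        by (intro le_imp_inverse_le) (auto simp: add_pos_nonneg)
      hence "real N * inverse (real (N * Suc j)) \<le> real N * inverse (real (1 + N * j))"
        by (rule mult_left_mono) simp
      moreover have "real N * inverse (real (N * Suc j)) = inverse (real (Suc j))"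
        unfolding of_nat_mult inverse_mult_distrib using N by (simp del: of_nat_Suc)
      ultimately show "inverse (real (Suc j)) \<le> real N * inverse (real (1 + N * j))" by simp
    qed
    also have "\<dots> \<le> real N * K" using le[of "Suc J"] by (simp add: mult_left_mono flip: sum_distrib_left)
    finally show "(\<Sum>j\<le>J. inverse (real (Suc j))) \<le> real N * K" .
  qed auto
  hence "summable (\<lambda>j. inverse (real j))" by (subst (asm) summable_Suc_iff)
  thus False using not_summable_harmonic by blast
qed

text \<open>By complete multiplicativity \<open>psi m\<close> splits over every factorization of
  \<open>m\<close>, so twisting the coefficients twists both characters.\<close>

lemma twisted_sigma_mult_cnj:
  assumes psi: "dirichlet_character N psi" and m: "m > 0"
  shows "cnj (psi (int m)) * twisted_sigma chi1 chi2 r m =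
     twisted_sigma (\<lambda>a. chi1 a * cnj (psi a)) (\<lambda>a. chi2 a * cnj (psi a)) r m"
  unfolding twisted_sigma_def sum_distrib_left
proof (rule sum.cong)
  fix d assume "d \<in> {d. d dvd m}"
  hence "m = m div d * d" by simp
  hence "psi (int m) = psi (int (m div d)) * psi (int d)"
    by (metis character_mult[OF psi] of_nat_mult)
  thus "cnj (psi (int m)) * (chi1 (int (m div d)) * chi2 (int d) * of_nat d ^ r) =
      chi1 (int (m div d)) * cnj (psi (int (m div d))) * (chi2 (int d) * cnj (psi (int d))) * of_nat d ^ r"
    by simp
qed simp

text \<open>If \<open>m\<close> is coprime to \<open>N\<close>, so are all its divisors; otherwise
  every factorization of \<open>m\<close> has a factor sharing a prime with \<open>N\<close>, and
  all terms vanish.\<close>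

lemma twisted_sigma_extend:
  assumes "m > 0"
  shows "twisted_sigma (extend_character N chi1) (extend_character N chi2) r m =
     (if coprime m N then twisted_sigma chi1 chi2 r m else 0)"
proof (cases "coprime m N")
  case True
  have "coprime (int (m div d)) (int N)" "coprime (int d) (int N)" if "d dvd m" for d
    using True that coprime_divisors[of _ m N N] by (auto simp: div_dvd_iff_mult elim!: dvdE)
  thus ?thesis using True by (simp add: twisted_sigma_def)
next
  case False
  have "extend_character N chi1 (int (m div d)) * extend_character N chi2 (int d) = 0" if "d dvd m" for d
  proof -
    have "m = m div d * d" using that by simp
    hence "\<not> (coprime (m div d) N \<and> coprime d N)" using False by (metis coprime_mult_left_iff)
    thus ?thesis by (auto simp: extend_character_def)
  qed
  hence "twisted_sigma (extend_character N chi1) (extend_character N chi2) r m = (\<Sum>d | d dvd m. 0)"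
    unfolding twisted_sigma_def by (intro sum.cong) auto
  thus ?thesis using False by simp
qed

section \<open>Combinations of twisted divisor sums are not bounded below\<close>

lemma has_sum_sum_finite:
  fixes f :: "'i \<Rightarrow> 'a \<Rightarrow> complex"
  assumes "finite I" "\<And>i. i \<in> I \<Longrightarrow> (f i has_sum S i) A"
  shows "((\<lambda>x. \<Sum>i\<in>I. f i x) has_sum (\<Sum>i\<in>I. S i)) A"
  using assms by (induction I rule: finite_induct) (auto intro: has_sum_add)

text \<open>The common modulus \<open>N\<close> makes each product of \<open>Y i\<close> with a
  conjugate \<open>Y j\<close> a character modulo \<open>N\<close> again, and injectivity of
  \<open>Y\<close> makes it principal only for i = j.\<close>

lemma sigma_combination_not_bounded_below:
  fixes X Y :: "'i \<Rightarrow> int \<Rightarrow> complex" and x :: "nat \<Rightarrow> real"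
  assumes fin: "finite I" and r: "r \<ge> 1"
    and X: "\<And>i. i \<in> I \<Longrightarrow> dirichlet_character N (X i)"
    and Y: "\<And>i. i \<in> I \<Longrightarrow> dirichlet_character N (Y i)"
    and nonprincipal: "\<And>i. i \<in> I \<Longrightarrow> \<exists>b. coprime b (int N) \<and> Y i b \<noteq> 1"
    and inj: "inj_on Y I"
    and i0: "i0 \<in> I" "c i0 \<noteq> 0"
    and x: "\<And>m. m > 0 \<Longrightarrow> (\<Sum>i\<in>I. c i * twisted_sigma (X i) (Y i) r m) = of_real (x m)"
  shows "\<exists>m>0. x m < - B"
proof (rule ccontr)
  assume "\<not> ?thesis"
  hence lower': "\<And>m. m > 0 \<Longrightarrow> x m \<ge> - B" by (meson not_less)
  \<comment> \<open>A nonnegative \<open>C\<close> with x \<ge> - C gives \<bar>x\<bar> \<le> x + 2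
    C, whatever the sign of \<open>B\<close>.\<close>
  define C where "C = max 0 B"
  have lower: "x m \<ge> - C" if "m > 0" for m
    using lower'[OF that] by (auto simp: C_def)
  have C: "C \<ge> 0" by (simp add: C_def)
  \<comment> \<open>Bounds, independently of \<open>u\<close>, both the untwisted series and the
    twisted one without its principal term: \<open>zeta2\<close> for the first factors,
    \<open>real N + 1\<close> for the second.\<close>
  define K where "K = (\<Sum>i\<in>I. norm (c i) * (zeta2 * (real N + 1)))"
  define psi where "psi = Y i0"
  have psi: "dirichlet_character N psi" using Y i0 by (simp add: psi_def)
  have N: "N > 0" using modulus_pos[OF psi] .
  define X' where "X' i = (\<lambda>a. X i a * cnj (psi a))" for i
  define Y' where "Y' i = (\<lambda>a. Y i a * cnj (psi a))" for i
  have X': "dirichlet_character N (X' i)" if "i \<in> I" for i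
    unfolding X'_def by (intro dirichlet_character_mult_cnj X psi that)
  have Y': "dirichlet_character N (Y' i)" if "i \<in> I" for i
    unfolding Y'_def by (intro dirichlet_character_mult_cnj Y psi that)
  have zeta2: "zeta2 \<ge> 0" unfolding zeta2_def by (rule infsum_nonneg) simp
  have nonprincipal': "\<exists>b. coprime b (int N) \<and> Y' i b \<noteq> 1" if i: "i \<in> I" "i \<noteq> i0" for i
  proof -
    have "Y i \<noteq> psi" using i i0 inj by (auto simp: psi_def inj_on_def)
    then obtain a where a: "Y i a \<noteq> psi a" by auto
    have cop: "coprime a (int N)"
      using a character_nz_iff[OF Y[OF i(1)], of a] character_nz_iff[OF psi, of a] by auto
    have "psi a * cnj (psi a) = 1" using character_norm[OF psi cop] by (simp add: complex_norm_square[symmetric])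
    \<comment> \<open>At a point where \<open>Y i\<close> and \<open>psi\<close> differ, the value 1
      would allow \<open>cnj (psi a)\<close> to be cancelled.\<close>
    hence "Y' i a \<noteq> 1" using a by (metis Y'_def mult_right_cancel mult_zero_right zero_neq_one)
    thus ?thesis using cop by blast
  qed
  \<comment> \<open>The numerator bounds \<open>D' i0\<close>; the 4 comes from the lower bound 1/4
    for the series of \<open>X' i0\<close>.\<close>
  have "(\<Sum>j<J. real (1 + N * j) powr - u) \<le> (2 * K + 2 * C * zeta2) * 4 / norm (c i0)"
    if u: "u > 1" for J u
  proof -
    define s where "s = u + real r"
    \<comment> \<open>Here \<open>r \<ge> 1\<close> enters: the first factors stay in the range of
      the uniform bounds as \<open>u\<close> tends to 1.\<close>
    have s: "s \<ge> 2" using u r by (simp add: s_def)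
    define D where "D = (\<Sum>i\<in>I. c i * (dirichlet_series (X i) s * dirichlet_series (Y i) u))"
    define D' where "D' i = c i * (dirichlet_series (X' i) s * dirichlet_series (Y' i) u)" for i
    have D: "((\<lambda>m. \<Sum>i\<in>I. c i * (twisted_sigma (X i) (Y i) r m * of_real (real m powr - s))) has_sum D) {0<..}"
      unfolding D_def s_def using u
      by (intro has_sum_sum_finite fin has_sum_cmult_right twisted_sigma_has_sum
          character_norm_le[OF X] character_norm_le[OF Y]) auto
    also have "?this \<longleftrightarrow> ((\<lambda>m. complex_of_real (x m * real m powr - s)) has_sum D) {0<..}"
    proof (rule has_sum_cong)
      fix m :: nat assume "m \<in> {0<..}"
      thus "(\<Sum>i\<in>I. c i * (twisted_sigma (X i) (Y i) r m * of_real (real m powr - s))) =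
          of_real (x m * real m powr - s)"
        by (simp add: x[symmetric] sum_distrib_right mult.assoc)
    qed
    finally have "((\<lambda>m. Re (complex_of_real (x m * real m powr - s))) has_sum Re D) {0<..}"
      by (rule has_sum_Re)
    hence xsum: "((\<lambda>m. x m * real m powr - s) has_sum Re D) {0<..}" by simp
    define Z where "Z = (\<Sum>\<^sub>\<infinity>m\<in>{0<..}. real m powr - s)"
    have Zsum: "((\<lambda>m. real m powr - s) has_sum Z) {0<..}"
      unfolding Z_def using s by (intro has_sum_infsum powr_minus_summable_on) simp
    have Z: "Z \<le> zeta2"
      using Zsum zeta2_has_sum by (rule has_sum_mono) (use s powr_minus_le_2 in auto)
    have "((\<lambda>m. \<Sum>i\<in>I. c i * (twisted_sigma (X' i) (Y' i) r m * of_real (real m powr - s)))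
        has_sum (\<Sum>i\<in>I. D' i)) {0<..}"
      unfolding D'_def s_def using u
      by (intro has_sum_sum_finite fin has_sum_cmult_right twisted_sigma_has_sum
          character_norm_le[OF X'] character_norm_le[OF Y']) auto
    \<comment> \<open>This series dominates the twisted one term by term, and its sum involves only
      the untwisted \<open>D\<close>, which stays bounded.\<close>
    moreover have "((\<lambda>m. x m * real m powr - s + 2 * C * real m powr - s) has_sum
        Re D + 2 * C * Z) {0<..}"
      by (intro has_sum_add xsum has_sum_cmult_right Zsum)
    ultimately have "norm (\<Sum>i\<in>I. D' i) \<le> Re D + 2 * C * Z"
    proof (rule norm_infsum_le)
      fix m :: nat assume "m \<in> {0<..}"
      hence m: "m > 0" by simp
      have "(\<Sum>i\<in>I. c i * (twisted_sigma (X' i) (Y' i) r m * of_real (real m powr - s))) =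
          cnj (psi (int m)) * of_real (x m) * of_real (real m powr - s)"
        unfolding x[OF m, symmetric] X'_def Y'_def twisted_sigma_mult_cnj[OF psi m, symmetric]
        by (simp add: sum_distrib_left sum_distrib_right mult_ac)
      also have "norm \<dots> = norm (psi (int m)) * (\<bar>x m\<bar> * real m powr - s)"
        by (simp add: norm_mult)
      also have "\<dots> \<le> 1 * (\<bar>x m\<bar> * real m powr - s)"
        by (intro mult_right_mono character_norm_le[OF psi]) simp
      also have "\<dots> \<le> 1 * ((x m + 2 * C) * real m powr - s)"
        using lower[OF m] C by (intro mult_left_mono mult_right_mono) auto
      finally show "norm (\<Sum>i\<in>I. c i * (twisted_sigma (X' i) (Y' i) r m * of_real (real m powr - s)))
          \<le> x m * real m powr - s + 2 * C * real m powr - s"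
        by (simp add: algebra_simps)
    qed
    also have "Re D \<le> K"
    proof -
      have "norm (c i * (dirichlet_series (X i) s * dirichlet_series (Y i) u)) \<le> norm (c i) * (zeta2 * (real N + 1))"
        if i: "i \<in> I" for i
      proof -
        obtain b where "coprime b (int N)" "Y i b \<noteq> 1" using nonprincipal[OF i] by blast
        thus ?thesis unfolding norm_mult
          by (intro mult_left_mono mult_mono norm_dirichlet_series_le[OF character_norm_le[OF X[OF i]] s]
              norm_dirichlet_series_nonprincipal_le[OF Y[OF i] _ _ u] zeta2) auto
      qed
      hence "norm D \<le> K" unfolding D_def K_def by (intro sum_norm_le)
      thus ?thesis using complex_Re_le_cmod[of D] by linarith
    qed
    finally have upper: "norm (\<Sum>i\<in>I. D' i) \<le> K + 2 * C * zeta2"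
      using mult_left_mono[OF Z, of "2 * C"] C by simp
    have rest: "norm (\<Sum>i\<in>I - {i0}. D' i) \<le> K"
    proof -
      have "norm (D' i) \<le> norm (c i) * (zeta2 * (real N + 1))" if i: "i \<in> I - {i0}" for i
      proof -
        have iI: "i \<in> I" using i by simp
        obtain b where "coprime b (int N)" "Y' i b \<noteq> 1" using nonprincipal' i by blast
        thus ?thesis unfolding norm_mult D'_def
          by (intro mult_left_mono mult_mono norm_dirichlet_series_le[OF character_norm_le[OF X'[OF iI]] s]
              norm_dirichlet_series_nonprincipal_le[OF Y'[OF iI] _ _ u] zeta2) auto
      qed
      hence "norm (\<Sum>i\<in>I - {i0}. D' i) \<le> (\<Sum>i\<in>I - {i0}. norm (c i) * (zeta2 * (real N + 1)))"
        by (rule sum_norm_le)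
      also have "\<dots> \<le> K" unfolding K_def using fin zeta2 by (intro sum_mono2) auto
      finally show ?thesis .
    qed
    \<comment> \<open>The one term with a principal second character is isolated; it inherits a
      bound from the total and the rest.\<close>
    have "(\<Sum>i\<in>I. D' i) = D' i0 + (\<Sum>i\<in>I - {i0}. D' i)" using fin i0 by (simp add: sum.remove)
    hence "D' i0 = (\<Sum>i\<in>I. D' i) - (\<Sum>i\<in>I - {i0}. D' i)" by simp
    hence D'0: "norm (D' i0) \<le> 2 * K + 2 * C * zeta2"
      using norm_triangle_ineq4[of "\<Sum>i\<in>I. D' i" "\<Sum>i\<in>I - {i0}. D' i"] upper rest by simp
    have "Y' i0 a = 1" if "coprime a (int N)" for a
      using character_norm[OF psi that] by (simp add: Y'_def psi_def complex_norm_square[symmetric])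
    hence low: "(\<Sum>j<J. real (1 + N * j) powr - u) \<le> norm (dirichlet_series (Y' i0) u)"
      using Y'[OF i0(1)] u by (intro norm_dirichlet_series_principal_ge) auto
    have "norm (dirichlet_series (X' i0) s) \<ge> 1 / 4"
      using character_norm_le[OF X'[OF i0(1)]] character_one[OF X'[OF i0(1)]] s
      by (rule norm_dirichlet_series_ge)
    hence "norm (c i0) * (1 / 4 * norm (dirichlet_series (Y' i0) u)) \<le> norm (D' i0)"
      unfolding D'_def norm_mult by (intro mult_left_mono mult_right_mono) auto
    with D'0 have "norm (c i0) * (1 / 4 * norm (dirichlet_series (Y' i0) u)) \<le> 2 * K + 2 * C * zeta2"
      by linarith
    hence "norm (dirichlet_series (Y' i0) u) \<le> (2 * K + 2 * C * zeta2) * 4 / norm (c i0)"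
      using i0(2) by (simp add: field_simps)
    with low show ?thesis by linarith
  qed
  thus False by (rule arithmetic_progression_sum_unbounded[OF N])
qed

section \<open>Fourier coefficients of Eisenstein series\<close>

text \<open>The constant term is the limit at 0; divide by \<open>x\<close> and iterate. The point 0
  is left out because exp(2 \<pi> i z) never takes that value.\<close>

lemma powser_eq_0_imp_coeff_eq_0:
  fixes a :: "nat \<Rightarrow> complex"
  assumes "\<And>x. x \<noteq> 0 \<Longrightarrow> norm x < 1 \<Longrightarrow> (\<lambda>n. a n * x ^ n) sums 0"
  shows "a n = 0"
  using assms
proof (induction n arbitrary: a)
  case 0
  have lim: "((\<lambda>_. 0) \<longlongrightarrow> a 0) (at (0::complex))"
    using 0 by (intro powser_limit_0_strong[of 1]) auto
  show ?case using tendsto_unique[OF _ lim tendsto_const] by simp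
next
  case (Suc n)
  have a0: "a 0 = 0"
  proof -
    have lim: "((\<lambda>_. 0) \<longlongrightarrow> a 0) (at (0::complex))"
      using Suc.prems by (intro powser_limit_0_strong[of 1]) auto
    show ?thesis using tendsto_unique[OF _ lim tendsto_const] by simp
  qed
  show ?case
  proof (rule Suc.IH[of "\<lambda>n. a (Suc n)"])
    fix x :: complex assume x: "x \<noteq> 0" "norm x < 1"
    have "(\<lambda>n. a (Suc n) * x ^ Suc n) sums 0"
      using Suc.prems[OF x] a0 by (subst sums_Suc_iff) simp
    from sums_mult[OF this, of "inverse x"] show "(\<lambda>n. a (Suc n) * x ^ n) sums 0"
      using x by (simp add: field_simps)
  qed
qed

text \<open>Every q with 0 < \<bar>q\<bar> < 1 comes from z = Ln q / (2 \<pi> i) in the upper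
  half-plane, so two expansions agree as power series on the punctured disc.\<close>

lemma fourier_coeff_eqI:
  assumes a: "\<And>z. Im z > 0 \<Longrightarrow> (\<lambda>n. a n * exp (2 * of_real pi * \<i> * z) ^ n) sums f z"
  shows "fourier_coeff f = a"
  unfolding fourier_coeff_def
proof (rule the_equality)
  show "\<forall>z. Im z > 0 \<longrightarrow> (\<lambda>n. a n * exp (2 * of_real pi * \<i> * z) ^ n) sums f z"
    using a by blast
next
  fix b assume b: "\<forall>z. Im z > 0 \<longrightarrow> (\<lambda>n. b n * exp (2 * of_real pi * \<i> * z) ^ n) sums f z"
  have "b n - a n = 0" for n
  proof (rule powser_eq_0_imp_coeff_eq_0)
    fix x :: complex assume x: "x \<noteq> 0" "norm x < 1"
    define z where "z = Ln x / (2 * of_real pi * \<i>)"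
    have "exp (2 * of_real pi * \<i> * z) = x" using x by (simp add: z_def)
    moreover have "Im z > 0"
    proof -
      have "z = - \<i> * Ln x / of_real (2 * pi)" by (simp add: z_def field_simps)
      hence "Im z = - ln (norm x) / (2 * pi)"
        using x by (simp del: of_real_mult)
      moreover have "ln (norm x) < 0" using x by simp
      ultimately show ?thesis by (simp add: divide_neg_pos)
    qed
    ultimately show "(\<lambda>n. (b n - a n) * x ^ n) sums 0"
      using sums_diff[OF b[rule_format, of z] a[of z]] by (simp add: algebra_simps)
  qed
  thus "b = a" by (simp add: fun_eq_iff)
qed

section \<open>Expansions of Eisenstein series and their shifts\<close>

lemma summable_nat_power_mult_power:
  fixes x :: complex
  assumes "norm x < 1"
  shows "summable (\<lambda>n. of_nat n ^ m * x ^ n)"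
  using assms
proof (induction m arbitrary: x)
  case 0
  thus ?case by (simp add: summable_geometric)
next
  case (Suc m)
  \<comment> \<open>Termwise differentiation raises the degree of the polynomial factor by
    one.\<close>
  have "summable (\<lambda>n. diffs (\<lambda>n. of_nat n ^ m) n * x ^ n)"
    using Suc by (intro termdiff_converges[of x 1]) auto
  from summable_mult2[OF this, of x]
  have "summable (\<lambda>n. of_nat (Suc n) ^ Suc m * x ^ Suc n)"
    by (simp add: diffs_def mult_ac)
  thus ?case by (subst (asm) summable_Suc_iff)
qed

lemma norm_twisted_sigma_le:
  assumes chi1: "\<And>a. norm (chi1 a) \<le> 1" and chi2: "\<And>a. norm (chi2 a) \<le> 1"
  shows "norm (twisted_sigma chi1 chi2 r n) \<le> real n ^ Suc r"
proof (cases "n = 0")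
  case False
  have "norm (twisted_sigma chi1 chi2 r n) \<le> (\<Sum>d | d dvd n. real n ^ r)"
    unfolding twisted_sigma_def
  proof (rule sum_norm_le)
    fix d assume "d \<in> {d. d dvd n}"
    hence d: "d \<le> n" using False by (simp add: dvd_imp_le)
    have "norm (chi1 (int (n div d)) * chi2 (int d) * of_nat d ^ r) \<le> 1 * 1 * real d ^ r"
      unfolding norm_mult norm_power norm_of_nat by (intro mult_mono chi1 chi2) auto
    also have "\<dots> \<le> real n ^ r" using d by (simp add: power_mono)
    finally show "norm (chi1 (int (n div d)) * chi2 (int d) * of_nat d ^ r) \<le> real n ^ r" .
  qed
  also have "\<dots> = real (card {d. d dvd n}) * real n ^ r" by simp
  also have "\<dots> \<le> real n * real n ^ r"
  proof (intro mult_right_mono)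
    have "{d. d dvd n} \<subseteq> {1..n}" using False by (auto simp: dvd_imp_le Suc_le_eq dest: dvd_pos_nat)
    hence "card {d. d dvd n} \<le> card {1..n}" by (intro card_mono) auto
    thus "real (card {d. d dvd n}) \<le> real n" by simp
  qed simp
  finally show ?thesis by simp
qed (simp add: twisted_sigma_def)

text \<open>Every \<open>d\<close> divides 0, so \<open>twisted_sigma\<close> at 0 is a sum over an
  infinite set and takes the default value 0; the constant term is therefore given
  separately.\<close>

definition eisenstein_coeff ::
    "(int \<Rightarrow> complex) \<Rightarrow> (int \<Rightarrow> complex) \<Rightarrow> nat \<Rightarrow> nat \<Rightarrow> complex" where
  "eisenstein_coeff chi1 chi2 k n =
     (if n = 0 then (if principal_character chi1 then 1 else 0) / 2 * dirichlet_L chi2 (1 - of_nat k)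
      else twisted_sigma chi1 chi2 (k - 1) n)"

lemma norm_exp_upper_half_plane:
  assumes "Im z > 0" shows "norm (exp (2 * of_real pi * \<i> * z)) < 1"
  using assms by simp

lemma eisenstein_sums:
  assumes chi1: "\<And>a. norm (chi1 a) \<le> 1" and chi2: "\<And>a. norm (chi2 a) \<le> 1" and z: "Im z > 0"
  shows "(\<lambda>n. eisenstein_coeff chi1 chi2 k n * exp (2 * of_real pi * \<i> * z) ^ n) sums eisenstein chi1 chi2 k z"
proof -
  define q where "q = exp (2 * of_real pi * \<i> * z)"
  have q: "norm q < 1" using norm_exp_upper_half_plane[OF z] by (simp add: q_def)
  let ?f = "\<lambda>n. twisted_sigma chi1 chi2 (k - 1) n * q ^ n"
  have "summable (\<lambda>n. norm (of_nat n ^ Suc (k - 1) * complex_of_real (norm q) ^ n))"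
  proof -
    have "summable (\<lambda>n. of_nat n ^ Suc (k - 1) * complex_of_real (norm q) ^ n)"
      using q by (intro summable_nat_power_mult_power) simp
    hence "summable (\<lambda>n. complex_of_real (real n ^ Suc (k - 1) * norm q ^ n))" by simp
    hence "summable (\<lambda>n. real n ^ Suc (k - 1) * norm q ^ n)" by (subst (asm) summable_complex_of_real)
    thus ?thesis by (simp add: norm_mult norm_power)
  qed
  hence "summable ?f"
    by (rule summable_comparison_test'[where N = 0])
      (auto simp: norm_mult norm_power simp del: power_Suc
        intro!: mult_right_mono norm_twisted_sigma_le chi1 chi2)
  hence "summable (\<lambda>n. ?f (Suc n))" by (subst summable_Suc_iff)
  hence "(\<lambda>n. ?f (Suc n)) sums (\<Sum>n. ?f (Suc n))" by (rule summable_sums)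
  hence "(\<lambda>n. eisenstein_coeff chi1 chi2 k (Suc n) * q ^ Suc n) sums (\<Sum>n. ?f (Suc n))"
    by (simp add: eisenstein_coeff_def)
  hence "(\<lambda>n. eisenstein_coeff chi1 chi2 k n * q ^ n) sums
      ((\<Sum>n. ?f (Suc n)) + eisenstein_coeff chi1 chi2 k 0 * q ^ 0)"
    by (subst (asm) sums_Suc_iff) simp
  thus ?thesis using z by (simp add: eisenstein_def eisenstein_coeff_def q_def add.commute)
qed

text \<open>Replacing z by d z replaces q by q^d, which moves the coefficients to the multiples of
  \<open>d\<close>.\<close>

lemma shift_sums:
  assumes f: "\<And>z. Im z > 0 \<Longrightarrow> (\<lambda>n. a n * exp (2 * of_real pi * \<i> * z) ^ n) sums f z"
    and d: "d > 0" and z: "Im z > 0"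
  shows "(\<lambda>n. (if d dvd n then a (n div d) else 0) * exp (2 * of_real pi * \<i> * z) ^ n) sums shift d f z"
proof -
  let ?g = "\<lambda>n. (if d dvd n then a (n div d) else 0) * exp (2 * of_real pi * \<i> * z) ^ n"
  have "exp (2 * of_real pi * \<i> * (of_nat d * z)) = exp (2 * of_real pi * \<i> * z) ^ d"
    by (simp add: exp_of_nat_mult[symmetric] mult_ac)
  hence "(\<lambda>n. ?g (d * n)) sums shift d f z"
    using f[of "of_nat d * z"] d z by (simp add: shift_def power_mult)
  moreover have "strict_mono (\<lambda>n. d * n)" using d by (simp add: strict_mono_def)
  moreover have "?g n = 0" if "n \<notin> range (\<lambda>n. d * n)" for n using that by (auto elim!: dvdE)
  ultimately show ?thesis using sums_mono_reindex[of "\<lambda>n. d * n" ?g] by blast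
qed

lemma fourier_coeff_combination:
  assumes fin: "finite I"
    and chi1: "\<And>i a. i \<in> I \<Longrightarrow> norm (chi1 i a) \<le> 1" and chi2: "\<And>i a. i \<in> I \<Longrightarrow> norm (chi2 i a) \<le> 1"
    and eis: "\<And>i. i \<in> I \<Longrightarrow> fst i = eisenstein (chi1 i) (chi2 i) k"
    and d: "\<And>i. i \<in> I \<Longrightarrow> snd i > 0"
  shows "fourier_coeff (\<lambda>z. \<Sum>(f, d)\<in>I. c (f, d) * shift d f z) =
    (\<lambda>n. \<Sum>i\<in>I. c i * (if snd i dvd n then eisenstein_coeff (chi1 i) (chi2 i) k (n div snd i) else 0))"
proof (rule fourier_coeff_eqI)
  fix z :: complex assume z: "Im z > 0"
  have "(\<lambda>n. \<Sum>i\<in>I. c i * ((if snd i dvd n then eisenstein_coeff (chi1 i) (chi2 i) k (n div snd i) else 0)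
      * exp (2 * of_real pi * \<i> * z) ^ n)) sums (\<Sum>i\<in>I. c i * shift (snd i) (fst i) z)"
    by (intro sums_sum sums_mult shift_sums d z) (simp add: eis eisenstein_sums chi1 chi2)
  thus "(\<lambda>n. (\<Sum>i\<in>I. c i * (if snd i dvd n then eisenstein_coeff (chi1 i) (chi2 i) k (n div snd i) else 0))
      * exp (2 * of_real pi * \<i> * z) ^ n) sums (\<Sum>(f, d)\<in>I. c (f, d) * shift d f z)"
    by (simp add: sum_distrib_right mult.assoc case_prod_beta)
qed

section \<open>Reduction to the coefficients at multiples of the smallest shift\<close>

theorem theorem6p8:
  fixes k N :: nat
    and chi :: "int \<Rightarrow> complex"
    and E :: "complex \<Rightarrow> complex"
    and I :: "((complex \<Rightarrow> complex) \<times> nat) set"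
    and c :: "(complex \<Rightarrow> complex) \<times> nat \<Rightarrow> complex"
  assumes "k \<ge> 2"
    and "dirichlet_character N chi"
    and "E \<in> eisenstein_space k N chi"
    and "E \<noteq> (\<lambda>z. 0)"
    and "\<forall>n. fourier_coeff E n \<in> \<rat>"
    and "newform_decomposition k N chi E I c"
    and "\<forall>M \<psi> d. primitive_character M \<psi> \<and> M dvd N \<and> chi = extend_character N \<psi>
           \<longrightarrow> (eisenstein \<psi> trivial_character k, d) \<notin> I"
  shows "\<forall>B::real. \<exists>n. Re (fourier_coeff E n) < 0 \<and> cmod (fourier_coeff E n) > B"
proof
  fix B :: real
  have N: "N > 0" using modulus_pos assms(2) by blast
  have fin: "finite I" and I: "I \<subseteq> newform_shifts k N chi" and c: "\<And>i. i \<in> I \<Longrightarrow> c i \<noteq> 0"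
    and E: "E = (\<lambda>z. \<Sum>(f, d)\<in>I. c (f, d) * shift d f z)"
    using assms(6) by (auto simp: newform_decomposition_def)
  have ex: "\<exists>N1 chi1 N2 chi2. primitive_character N1 chi1 \<and> primitive_character N2 chi2 \<and>
      N1 * N2 dvd N \<and> chi = extend_character N (\<lambda>a. chi1 a * chi2 a) \<and>
      fst i = eisenstein chi1 chi2 k \<and> snd i dvd N" if "i \<in> I" for i
  proof -
    have "(fst i, snd i) \<in> newform_shifts k N chi" using I that by auto
    then obtain M \<psi> where *: "eisenstein_newform k M \<psi> (fst i)" "M dvd N"
        "chi = extend_character N \<psi>" "snd i dvd N div M"
      unfolding newform_shifts_def by blast
    have "snd i dvd N" using *(2,4) by (metis dvd_div_mult_self dvd_mult2)
    thus ?thesis using * unfolding eisenstein_newform_def by blast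
  qed
  \<comment> \<open>Elements of \<open>I\<close> carry only functions and shifts; fix for each one a
    pair of primitive characters producing it.\<close>
  have "\<forall>i\<in>I. \<exists>N1 chi1 N2 chi2. primitive_character N1 chi1 \<and> primitive_character N2 chi2 \<and>
      N1 * N2 dvd N \<and> chi = extend_character N (\<lambda>a. chi1 a * chi2 a) \<and>
      fst i = eisenstein chi1 chi2 k \<and> snd i dvd N"
    by (intro ballI ex)
  then obtain N1 chi1 N2 chi2 where data: "\<forall>i\<in>I.
      primitive_character (N1 i) (chi1 i) \<and> primitive_character (N2 i) (chi2 i) \<and>
      N1 i * N2 i dvd N \<and> chi = extend_character N (\<lambda>a. chi1 i a * chi2 i a) \<and>
      fst i = eisenstein (chi1 i) (chi2 i) k \<and> snd i dvd N"
    unfolding bchoice_iff by (elim exE)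
  have prim1: "primitive_character (N1 i) (chi1 i)" and prim2: "primitive_character (N2 i) (chi2 i)"
    and N1: "N1 i dvd N" and N2: "N2 i dvd N"
    and chi: "chi = extend_character N (\<lambda>a. chi1 i a * chi2 i a)"
    and eis: "fst i = eisenstein (chi1 i) (chi2 i) k" and snd: "snd i dvd N" if "i \<in> I" for i
    using bspec[OF data that] by (auto intro: dvd_mult_left dvd_mult_right)
  have dir1: "dirichlet_character (N1 i) (chi1 i)" and dir2: "dirichlet_character (N2 i) (chi2 i)"
    if "i \<in> I" for i
    using prim1[OF that] prim2[OF that] by (simp_all add: primitive_character_def)
  have pos: "snd i > 0" if "i \<in> I" for i using snd[OF that] N by (rule dvd_pos_nat[rotated])
  have coeff: "fourier_coeff E n = (\<Sum>i\<in>I. c i *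
      (if snd i dvd n then eisenstein_coeff (chi1 i) (chi2 i) k (n div snd i) else 0))" for n
    unfolding E
    by (subst fourier_coeff_combination[where ?chi1.0 = chi1 and ?chi2.0 = chi2 and k = k])
      (use fin eis pos character_norm_le[OF dir1] character_norm_le[OF dir2] in auto)
  \<comment> \<open>Modulus 1 would make \<open>chi2 i\<close> trivial and \<open>chi1 i\<close> the
    primitive character inducing \<open>chi\<close>, which is the excluded newform.\<close>
  have N2_ne_1: "N2 i \<noteq> 1" if i: "i \<in> I" for i
  proof
    assume "N2 i = 1"
    hence triv: "chi2 i = trivial_character" using dir2[OF i] dirichlet_character_1 by metis
    have "chi = extend_character N (chi1 i)"
      using chi[OF i] triv by (simp add: trivial_character_def)
    hence "(eisenstein (chi1 i) trivial_character k, snd i) \<notin> I"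
      using assms(7) prim1[OF i] N1[OF i] by blast
    thus False using i eis[OF i] triv by (metis prod.collapse)
  qed

  have "I \<noteq> {}" using assms(4) E by auto
  define d0 where "d0 = Min (snd ` I)"
  define I0 where "I0 = {i \<in> I. snd i = d0}"
  have "d0 \<in> snd ` I" unfolding d0_def using fin \<open>I \<noteq> {}\<close> by (intro Min_in) auto
  then obtain i0 where i0: "i0 \<in> I0" unfolding I0_def by auto
  have d0_pos: "d0 > 0" using pos[of i0] i0 by (simp add: I0_def)
  define X where "X i = extend_character N (chi1 i)" for i
  define Y where "Y i = extend_character N (chi2 i)" for i
  have X: "dirichlet_character N (X i)" and Y: "dirichlet_character N (Y i)" if "i \<in> I" for i
    unfolding X_def Y_def
    by (rule dirichlet_character_extend[OF dir1[OF that] N1[OF that] N],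
        rule dirichlet_character_extend[OF dir2[OF that] N2[OF that] N])
  have nonprincipal: "\<exists>b. coprime b (int N) \<and> Y i b \<noteq> 1" if i: "i \<in> I" for i
  proof (rule ccontr)
    assume "\<not> ?thesis"
    \<comment> \<open>A primitive character that becomes principal modulo \<open>N\<close> is the
      trivial one, by uniqueness.\<close>
    hence "extend_character N (chi2 i) = extend_character N trivial_character"
      by (auto simp: extend_character_eq_iff Y_def trivial_character_def)
    hence "N2 i = 1"
      by (rule primitive_character_unique[OF prim2[OF i] primitive_trivial N])
    thus False using N2_ne_1[OF i] by blast
  qed
  \<comment> \<open>With the shift fixed, \<open>chi2\<close> determines \<open>chi1\<close> because
    their product is \<open>chi\<close> on integers coprime to \<open>N\<close>, and together they
    determine the newform.\<close>
  have "inj_on Y I0"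
  proof (rule inj_onI)
    fix i j assume "i \<in> I0" "j \<in> I0" and eq: "Y i = Y j"
    hence i: "i \<in> I" and j: "j \<in> I" and sndij: "snd i = snd j" by (auto simp: I0_def)
    have chi2: "chi2 i = chi2 j"
      using eq unfolding Y_def
      by (rule primitive_character_unique[OF prim2[OF i] prim2[OF j] N])
    have "extend_character N (chi1 i) = extend_character N (chi1 j)"
      unfolding extend_character_eq_iff
    proof (intro allI impI)
      fix a assume a: "coprime a (int N)"
      have "chi1 i a * chi2 i a = chi1 j a * chi2 i a"
        using fun_cong[OF chi[OF i], of a] fun_cong[OF chi[OF j], of a] a chi2 by auto
      moreover have "chi2 i a \<noteq> 0"
        using character_nz_iff[OF Y[OF i], of a] a by (simp add: Y_def)
      ultimately show "chi1 i a = chi1 j a" by simp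
    qed
    hence "chi1 i = chi1 j"
      by (rule primitive_character_unique[OF prim1[OF i] prim1[OF j] N])
    thus "i = j" using chi2 sndij eis[OF i] eis[OF j] by (simp add: prod_eq_iff)
  qed
  \<comment> \<open>The value 0 matches the divisor sums of the extended characters, which vanish
    when \<open>m\<close> is not coprime to \<open>N\<close>.\<close>
  define x where "x m = (if coprime m N then Re (fourier_coeff E (d0 * m)) else 0)" for m
  have real: "fourier_coeff E n = of_real (Re (fourier_coeff E n))" for n
  proof -
    obtain a b where "fourier_coeff E n = of_int a / of_int b"
      using assms(5) by (elim allE[of _ n] Rats_cases')
    hence "fourier_coeff E n = of_real (of_int a / of_int b)" by simp
    thus ?thesis by (simp only: Re_complex_of_real)
  qed
  have "(\<Sum>i\<in>I0. c i * twisted_sigma (X i) (Y i) (k - 1) m) = of_real (x m)" if m: "m > 0" for m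
  proof (cases "coprime m N")
    case True
    \<comment> \<open>A shift divides \<open>N\<close>, so it is coprime to \<open>m\<close> and
      must divide \<open>d0\<close>; minimality of \<open>d0\<close> gives equality.\<close>
    have dvd: "snd i dvd d0 * m \<longleftrightarrow> snd i = d0" if i: "i \<in> I" for i
    proof
      assume "snd i dvd d0 * m"
      moreover have "coprime (snd i) m"
        using True snd[OF i] by (metis coprime_commute coprime_divisors dvd_refl)
      ultimately have "snd i dvd d0" by (simp add: coprime_dvd_mult_left_iff)
      hence "snd i \<le> d0" using d0_pos by (rule dvd_imp_le)
      moreover have "d0 \<le> snd i" unfolding d0_def using fin i by (intro Min_le) auto
      ultimately show "snd i = d0" by simp
    qed simp
    have "fourier_coeff E (d0 * m) = (\<Sum>i\<in>I0. c i * eisenstein_coeff (chi1 i) (chi2 i) k m)"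
      unfolding coeff using fin
    proof (rule sum.mono_neutral_cong_right)
      show "I0 \<subseteq> I" unfolding I0_def by blast
      show "\<forall>i\<in>I - I0. c i * (if snd i dvd d0 * m
          then eisenstein_coeff (chi1 i) (chi2 i) k (d0 * m div snd i) else 0) = 0"
        by (simp add: I0_def dvd)
      show "c i * (if snd i dvd d0 * m
          then eisenstein_coeff (chi1 i) (chi2 i) k (d0 * m div snd i) else 0) =
          c i * eisenstein_coeff (chi1 i) (chi2 i) k m" if "i \<in> I0" for i
        using that d0_pos by (simp add: I0_def)
    qed
    also have "\<dots> = (\<Sum>i\<in>I0. c i * twisted_sigma (X i) (Y i) (k - 1) m)"
      using m True by (simp add: X_def Y_def twisted_sigma_extend eisenstein_coeff_def)
    finally show ?thesis using True real[of "d0 * m"] by (simp add: x_def)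
  next
    case False
    thus ?thesis using m by (simp add: X_def Y_def twisted_sigma_extend x_def)
  qed
  moreover have "finite I0" using fin by (simp add: I0_def)
  moreover have "i \<in> I" if "i \<in> I0" for i using that by (simp add: I0_def)
  \<comment> \<open>Using \<bar>B\<bar> yields a negative value of large modulus even if
    \<open>B\<close> is negative, and excludes the default value 0 of \<open>x\<close>.\<close>
  ultimately have "\<exists>m>0. x m < - \<bar>B\<bar>"
    using assms(1) \<open>inj_on Y I0\<close> i0
    by (intro sigma_combination_not_bounded_below[where I = I0 and N = N and X = X and Y = Y
          and ?i0.0 = i0 and c = c and r = "k - 1"] X Y nonprincipal c)
       simp_all
  then obtain m where m: "x m < - \<bar>B\<bar>" by blast
  hence neg: "Re (fourier_coeff E (d0 * m)) < - \<bar>B\<bar>" by (auto simp: x_def split: if_splits)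
  moreover have "\<bar>Re (fourier_coeff E (d0 * m))\<bar> \<le> cmod (fourier_coeff E (d0 * m))"
    by (rule abs_Re_le_cmod)
  ultimately show "\<exists>n. Re (fourier_coeff E n) < 0 \<and> cmod (fourier_coeff E n) > B"
    by (intro exI[of _ "d0 * m"]) linarith
qed

end
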